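(* Let $D$ be a $\varphi$KT-connection with torsion $T$ and curvature tensor $K$ on an almost contact B-metric manifold $(M,\varphi,\xi,\eta,g)$. Then $K$ is of $\varphi$-Kähler type if and only if it has the form $$K(x,y,z,w)=R(x,y,z,w)+\tfrac14 g\bigl(T(x,y),T(z,w)\bigr)-\tfrac1{12}\mathop{\mathfrak{S}}_{x,y,z}\bigl\{g\bigl(T(x,y),T(z,w)\bigr)\bigr\}$$ for all vector fields $x,y,z,w$.
   Context: An almost contact B-metric manifold $(M,\varphi,\xi,\eta,g)$ is a $(2n+1)$-dimensional smooth manifold $M$ with a field of endomorphisms $\varphi$ of the tangent bundle, a vector field $\xi$, a 1-form $\eta$ and a pseudo-Riemannian metric $g$ of signature $(n,n+1)$ ($n$ negative and $n+1$ positive directions) such that $\varphi\xi=0$, $\varphi^2=-\mathrm{Id}+\eta\otimes\xi$, $\eta\circ\varphi=0$, $\eta(\xi)=1$, $g(\varphi x,\varphi y)=-g(x,y)+\eta(x)\eta(y)$. $\nabla$ is the Levi-Civita connection of $g$. $\mathfrak{S}_{x,y,z}$ denotes the cyclic sum over $x,y,z$ ($w$ fixed). A natural connection is a linear connection $D$ with $D\varphi=0$, $D\xi=0$, $D\eta=0$, $Dg=0$. Its torsion is $T(x,y)=D_xy-D_yx-[x,y]$, with $T(x,y,z)=g(T(x,y),z)$. A $\varphi$KT-connection is a natural connection whose torsion $T(x,y,z)$ is totally skew-symmetric (a 3-form). Curvatures: $R(x,y)z=[\nabla_x,\nabla_y]z-\nabla_{[x,y]}z$, $R(x,y,z,w)=g(R(x,y)z,w)$;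 $K(x,y)z=[D_x,D_y]z-D_{[x,y]}z$, $K(x,y,z,w)=g(K(x,y)z,w)$. A $(0,4)$-tensor $L$ is of $\varphi$-Kähler type if $L(x,y,z,w)=-L(y,x,z,w)=-L(x,y,w,z)$, $\mathfrak{S}_{x,y,z}L(x,y,z,w)=0$ and $L(x,y,\varphi z,\varphi w)=-L(x,y,z,w)$. *)

theory Defs
  imports "HOL-Analysis.Analysis" "HOL-Library.Function_Algebras"
begin

instantiation "fun" :: (type, real_vector) real_vector
begin

definition scaleR_fun :: "real \<Rightarrow> ('a \<Rightarrow> 'b) \<Rightarrow> 'a \<Rightarrow> 'b"
  where "scaleR_fun r f = (\<lambda>x. r *\<^sub>R f x)"

instance
  by standard (simp_all add: scaleR_fun_def plus_fun_def fun_eq_iff algebra_simps)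

end


section \<open>Smooth manifolds and smooth functions\<close>

text \<open>\<open>C_k S f k\<close> is only meant for open \<open>S\<close>: the function \<open>f\<close> is \<open>k\<close> times continuously
  differentiable on \<open>S\<close>, expressed through iterated directional derivatives.\<close>

primrec C_k :: "'a::real_normed_vector set \<Rightarrow> ('a \<Rightarrow> 'b::real_normed_vector) \<Rightarrow> nat \<Rightarrow> bool" where
  "C_k S f 0 \<longleftrightarrow> continuous_on S f"
| "C_k S f (Suc k) \<longleftrightarrow> (\<forall>u\<in>S. f differentiable (at u)) \<and>
     (\<forall>v. C_k S (\<lambda>u. frechet_derivative f (at u) v) k)"

definition C_infinity_on :: "'a::real_normed_vector set \<Rightarrow> ('a \<Rightarrow> 'b::real_normed_vector) \<Rightarrow> bool"
  where "C_infinity_on S f \<longleftrightarrow> (\<forall>k. C_k S f k)"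

text \<open>A chart is a pair of its domain and its coordinate map; an atlas is a set of charts.
  The manifold is the whole topological space \<open>'m\<close>, and its dimension is \<open>DIM('e)\<close>.\<close>

type_synonym ('m, 'e) atlas = "('m set \<times> ('m \<Rightarrow> 'e)) set"

locale smooth_manifold =
  fixes A :: "('m::{t2_space,second_countable_topology}, 'e::euclidean_space) atlas"
  assumes chart_open: "(U, \<psi>) \<in> A \<Longrightarrow> open U \<and> open (\<psi> ` U)"
    and chart_homeomorphism: "(U, \<psi>) \<in> A \<Longrightarrow> homeomorphism U (\<psi> ` U) \<psi> (inv_into U \<psi>)"
    and charts_cover: "(\<Union>(U, \<psi>)\<in>A. U) = UNIV"
    and charts_compatible: "(U, \<psi>) \<in> A \<Longrightarrow> (V, \<theta>) \<in> A \<Longrightarrow>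
      C_infinity_on (\<psi> ` (U \<inter> V)) (\<theta> \<circ> inv_into U \<psi>)"

definition smooth_functions :: "('m, 'e::euclidean_space) atlas \<Rightarrow> ('m \<Rightarrow> real) set"
  where "smooth_functions A =
    {f. \<forall>(U, \<psi>)\<in>A. C_infinity_on (\<psi> ` U) (f \<circ> inv_into U \<psi>)}"


section \<open>Tangent vectors, vector fields and tensor fields\<close>

text \<open>Tangent vectors at \<open>p\<close> are the derivations at \<open>p\<close> of the algebra of smooth functions.
  They are set to \<open>0\<close> on non-smooth functions, so that equality of tangent vectors is equality
  in HOL.\<close>

type_synonym 'm tvec = "('m \<Rightarrow> real) \<Rightarrow> real"

definition tangent_space :: "('m, 'e::euclidean_space) atlas \<Rightarrow> 'm \<Rightarrow> 'm tvec set"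
  where "tangent_space A p = {v.
    (\<forall>f\<in>smooth_functions A. \<forall>h\<in>smooth_functions A. v (f + h) = v f + v h) \<and>
    (\<forall>r. \<forall>f\<in>smooth_functions A. v (r *\<^sub>R f) = r * v f) \<and>
    (\<forall>f\<in>smooth_functions A. \<forall>h\<in>smooth_functions A. v (f * h) = f p * v h + h p * v f) \<and>
    (\<forall>f. f \<notin> smooth_functions A \<longrightarrow> v f = 0)}"

type_synonym 'm vfield = "'m \<Rightarrow> 'm tvec"

definition app_field :: "'m vfield \<Rightarrow> ('m \<Rightarrow> real) \<Rightarrow> 'm \<Rightarrow> real"
  where "app_field x f = (\<lambda>p. x p f)"

definition vector_fields :: "('m, 'e::euclidean_space) atlas \<Rightarrow> 'm vfield set"
  where "vector_fields A = {x. (\<forall>p. x p \<in> tangent_space A p) \<and>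
    (\<forall>f\<in>smooth_functions A. app_field x f \<in> smooth_functions A)}"

definition fscale :: "('m \<Rightarrow> real) \<Rightarrow> 'm vfield \<Rightarrow> 'm vfield"
  where "fscale f x = (\<lambda>p. f p *\<^sub>R x p)"

definition lie_bracket :: "'m vfield \<Rightarrow> 'm vfield \<Rightarrow> 'm vfield"
  where "lie_bracket x y = (\<lambda>p f. x p (app_field y f) - y p (app_field x f))"

definition app_endo :: "('m \<Rightarrow> 'm tvec \<Rightarrow> 'm tvec) \<Rightarrow> 'm vfield \<Rightarrow> 'm vfield"
  where "app_endo \<phi> x = (\<lambda>p. \<phi> p (x p))"

definition app_form :: "('m \<Rightarrow> 'm tvec \<Rightarrow> real) \<Rightarrow> 'm vfield \<Rightarrow> 'm \<Rightarrow> real"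
  where "app_form \<eta> x = (\<lambda>p. \<eta> p (x p))"

definition app_metric ::
    "('m \<Rightarrow> 'm tvec \<Rightarrow> 'm tvec \<Rightarrow> real) \<Rightarrow> 'm vfield \<Rightarrow> 'm vfield \<Rightarrow> 'm \<Rightarrow> real"
  where "app_metric g x y = (\<lambda>p. g p (x p) (y p))"

definition endomorphism_field ::
    "('m, 'e::euclidean_space) atlas \<Rightarrow> ('m \<Rightarrow> 'm tvec \<Rightarrow> 'm tvec) \<Rightarrow> bool"
  where "endomorphism_field A \<phi> \<longleftrightarrow>
    (\<forall>p. \<forall>u\<in>tangent_space A p. \<forall>v\<in>tangent_space A p. \<forall>r.
      \<phi> p u \<in> tangent_space A p \<and>
      \<phi> p (u + v) = \<phi> p u + \<phi> p v \<and> \<phi> p (r *\<^sub>R u) = r *\<^sub>R \<phi> p u) \<and>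
    (\<forall>x\<in>vector_fields A. app_endo \<phi> x \<in> vector_fields A)"

definition one_form :: "('m, 'e::euclidean_space) atlas \<Rightarrow> ('m \<Rightarrow> 'm tvec \<Rightarrow> real) \<Rightarrow> bool"
  where "one_form A \<eta> \<longleftrightarrow>
    (\<forall>p. \<forall>u\<in>tangent_space A p. \<forall>v\<in>tangent_space A p. \<forall>r.
      \<eta> p (u + v) = \<eta> p u + \<eta> p v \<and> \<eta> p (r *\<^sub>R u) = r * \<eta> p u) \<and>
    (\<forall>x\<in>vector_fields A. app_form \<eta> x \<in> smooth_functions A)"

text \<open>A metric of signature \<open>(r, s)\<close> has \<open>r\<close> negative and \<open>s\<close> positive directions in every
  tangent space. An orthonormal family spanning the tangent space is automatically a basis, and
  its existence makes the metric non-degenerate.\<close>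

definition pseudo_riemannian_metric :: "('m, 'e::euclidean_space) atlas \<Rightarrow> nat \<Rightarrow> nat \<Rightarrow>
    ('m \<Rightarrow> 'm tvec \<Rightarrow> 'm tvec \<Rightarrow> real) \<Rightarrow> bool"
  where "pseudo_riemannian_metric A r s g \<longleftrightarrow>
    (\<forall>p. \<forall>u\<in>tangent_space A p. \<forall>v\<in>tangent_space A p. \<forall>w\<in>tangent_space A p. \<forall>a.
      g p u v = g p v u \<and>
      g p (u + v) w = g p u w + g p v w \<and> g p (a *\<^sub>R u) w = a * g p u w) \<and>
    (\<forall>x\<in>vector_fields A. \<forall>y\<in>vector_fields A. app_metric g x y \<in> smooth_functions A) \<and>
    (\<forall>p. \<exists>e :: nat \<Rightarrow> 'm tvec.
      (\<forall>i<r + s. e i \<in> tangent_space A p) \<and> span (e ` {..<r + s}) = tangent_space A p \<and>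
      (\<forall>i<r + s. \<forall>j<r + s. g p (e i) (e j) = (if i \<noteq> j then 0 else if i < r then -1 else 1)))"


section \<open>Almost contact B-metric manifolds\<close>

locale almost_contact_B_metric = smooth_manifold A
  for A :: "('m::{t2_space,second_countable_topology}, 'e::euclidean_space) atlas" +
  fixes n :: nat
    and \<phi> :: "'m \<Rightarrow> 'm tvec \<Rightarrow> 'm tvec" and \<xi> :: "'m vfield"
    and \<eta> :: "'m \<Rightarrow> 'm tvec \<Rightarrow> real" and g :: "'m \<Rightarrow> 'm tvec \<Rightarrow> 'm tvec \<Rightarrow> real"
  assumes dim: "DIM('e) = 2 * n + 1"
    and endomorphism: "endomorphism_field A \<phi>"
    and xi_field: "\<xi> \<in> vector_fields A"
    and eta_form: "one_form A \<eta>"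
    and metric: "pseudo_riemannian_metric A n (n + 1) g"
    and phi_xi: "\<phi> p (\<xi> p) = 0"
    and phi_phi: "u \<in> tangent_space A p \<Longrightarrow> \<phi> p (\<phi> p u) = - u + \<eta> p u *\<^sub>R \<xi> p"
    and eta_phi: "u \<in> tangent_space A p \<Longrightarrow> \<eta> p (\<phi> p u) = 0"
    and eta_xi: "\<eta> p (\<xi> p) = 1"
    and B_metric: "u \<in> tangent_space A p \<Longrightarrow> v \<in> tangent_space A p \<Longrightarrow>
      g p (\<phi> p u) (\<phi> p v) = - g p u v + \<eta> p u * \<eta> p v"


section \<open>Connections, torsion and curvature\<close>

definition linear_connection ::
    "('m, 'e::euclidean_space) atlas \<Rightarrow> ('m vfield \<Rightarrow> 'm vfield \<Rightarrow> 'm vfield) \<Rightarrow> bool"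
  where "linear_connection A D \<longleftrightarrow>
    (\<forall>x\<in>vector_fields A. \<forall>y\<in>vector_fields A. \<forall>z\<in>vector_fields A. \<forall>f\<in>smooth_functions A.
      D x y \<in> vector_fields A \<and>
      D (x + y) z = D x z + D y z \<and> D (fscale f x) y = fscale f (D x y) \<and>
      D x (y + z) = D x y + D x z \<and>
      D x (fscale f y) = fscale (app_field x f) y + fscale f (D x y))"

definition torsion :: "('m vfield \<Rightarrow> 'm vfield \<Rightarrow> 'm vfield) \<Rightarrow> 'm vfield \<Rightarrow> 'm vfield \<Rightarrow> 'm vfield"
  where "torsion D x y = D x y - D y x - lie_bracket x y"

definition torsion3 :: "('m \<Rightarrow> 'm tvec \<Rightarrow> 'm tvec \<Rightarrow> real) \<Rightarrow>
    ('m vfield \<Rightarrow> 'm vfield \<Rightarrow> 'm vfield) \<Rightarrow> 'm vfield \<Rightarrow> 'm vfield \<Rightarrow> 'm vfield \<Rightarrow> 'm \<Rightarrow> real"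
  where "torsion3 g D x y z = app_metric g (torsion D x y) z"

definition curvature :: "('m vfield \<Rightarrow> 'm vfield \<Rightarrow> 'm vfield) \<Rightarrow>
    'm vfield \<Rightarrow> 'm vfield \<Rightarrow> 'm vfield \<Rightarrow> 'm vfield"
  where "curvature D x y z = D x (D y z) - D y (D x z) - D (lie_bracket x y) z"

definition curvature4 :: "('m \<Rightarrow> 'm tvec \<Rightarrow> 'm tvec \<Rightarrow> real) \<Rightarrow>
    ('m vfield \<Rightarrow> 'm vfield \<Rightarrow> 'm vfield) \<Rightarrow>
    'm vfield \<Rightarrow> 'm vfield \<Rightarrow> 'm vfield \<Rightarrow> 'm vfield \<Rightarrow> 'm \<Rightarrow> real"
  where "curvature4 g D x y z w = app_metric g (curvature D x y z) w"

definition cov_endo :: "('m vfield \<Rightarrow> 'm vfield \<Rightarrow> 'm vfield) \<Rightarrow>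
    ('m \<Rightarrow> 'm tvec \<Rightarrow> 'm tvec) \<Rightarrow> 'm vfield \<Rightarrow> 'm vfield \<Rightarrow> 'm vfield"
  where "cov_endo D \<phi> x y = D x (app_endo \<phi> y) - app_endo \<phi> (D x y)"

definition cov_form :: "('m vfield \<Rightarrow> 'm vfield \<Rightarrow> 'm vfield) \<Rightarrow>
    ('m \<Rightarrow> 'm tvec \<Rightarrow> real) \<Rightarrow> 'm vfield \<Rightarrow> 'm vfield \<Rightarrow> 'm \<Rightarrow> real"
  where "cov_form D \<eta> x y = app_field x (app_form \<eta> y) - app_form \<eta> (D x y)"

definition cov_metric :: "('m vfield \<Rightarrow> 'm vfield \<Rightarrow> 'm vfield) \<Rightarrow>
    ('m \<Rightarrow> 'm tvec \<Rightarrow> 'm tvec \<Rightarrow> real) \<Rightarrow> 'm vfield \<Rightarrow> 'm vfield \<Rightarrow> 'm vfield \<Rightarrow> 'm \<Rightarrow> real"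
  where "cov_metric D g x y z =
    app_field x (app_metric g y z) - app_metric g (D x y) z - app_metric g y (D x z)"

definition levi_civita :: "('m, 'e::euclidean_space) atlas \<Rightarrow>
    ('m \<Rightarrow> 'm tvec \<Rightarrow> 'm tvec \<Rightarrow> real) \<Rightarrow> ('m vfield \<Rightarrow> 'm vfield \<Rightarrow> 'm vfield) \<Rightarrow> bool"
  where "levi_civita A g D \<longleftrightarrow> linear_connection A D \<and>
    (\<forall>x\<in>vector_fields A. \<forall>y\<in>vector_fields A. torsion D x y = 0) \<and>
    (\<forall>x\<in>vector_fields A. \<forall>y\<in>vector_fields A. \<forall>z\<in>vector_fields A. cov_metric D g x y z = 0)"

definition natural_connection :: "('m, 'e::euclidean_space) atlas \<Rightarrow>
    ('m \<Rightarrow> 'm tvec \<Rightarrow> 'm tvec) \<Rightarrow> 'm vfield \<Rightarrow> ('m \<Rightarrow> 'm tvec \<Rightarrow> real) \<Rightarrow>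
    ('m \<Rightarrow> 'm tvec \<Rightarrow> 'm tvec \<Rightarrow> real) \<Rightarrow> ('m vfield \<Rightarrow> 'm vfield \<Rightarrow> 'm vfield) \<Rightarrow> bool"
  where "natural_connection A \<phi> \<xi> \<eta> g D \<longleftrightarrow> linear_connection A D \<and>
    (\<forall>x\<in>vector_fields A. \<forall>y\<in>vector_fields A. cov_endo D \<phi> x y = 0) \<and>
    (\<forall>x\<in>vector_fields A. D x \<xi> = 0) \<and>
    (\<forall>x\<in>vector_fields A. \<forall>y\<in>vector_fields A. cov_form D \<eta> x y = 0) \<and>
    (\<forall>x\<in>vector_fields A. \<forall>y\<in>vector_fields A. \<forall>z\<in>vector_fields A. cov_metric D g x y z = 0)"

definition phiKT_connection :: "('m, 'e::euclidean_space) atlas \<Rightarrow>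
    ('m \<Rightarrow> 'm tvec \<Rightarrow> 'm tvec) \<Rightarrow> 'm vfield \<Rightarrow> ('m \<Rightarrow> 'm tvec \<Rightarrow> real) \<Rightarrow>
    ('m \<Rightarrow> 'm tvec \<Rightarrow> 'm tvec \<Rightarrow> real) \<Rightarrow> ('m vfield \<Rightarrow> 'm vfield \<Rightarrow> 'm vfield) \<Rightarrow> bool"
  where "phiKT_connection A \<phi> \<xi> \<eta> g D \<longleftrightarrow> natural_connection A \<phi> \<xi> \<eta> g D \<and>
    (\<forall>x\<in>vector_fields A. \<forall>y\<in>vector_fields A. \<forall>z\<in>vector_fields A.
      torsion3 g D x y z = - torsion3 g D y x z \<and> torsion3 g D x y z = - torsion3 g D x z y)"

definition cyclic_sum :: "('a \<Rightarrow> 'a \<Rightarrow> 'a \<Rightarrow> 'b::comm_monoid_add) \<Rightarrow> 'a \<Rightarrow> 'a \<Rightarrow> 'a \<Rightarrow> 'b"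
  where "cyclic_sum F x y z = F x y z + F y z x + F z x y"

text \<open>The argument \<open>L\<close> is meant to be a \<open>(0,4)\<close>-tensor field, acting on vector fields.\<close>

definition phi_Kahler_type :: "('m, 'e::euclidean_space) atlas \<Rightarrow>
    ('m \<Rightarrow> 'm tvec \<Rightarrow> 'm tvec) \<Rightarrow>
    ('m vfield \<Rightarrow> 'm vfield \<Rightarrow> 'm vfield \<Rightarrow> 'm vfield \<Rightarrow> 'm \<Rightarrow> real) \<Rightarrow> bool"
  where "phi_Kahler_type A \<phi> L \<longleftrightarrow>
    (\<forall>x\<in>vector_fields A. \<forall>y\<in>vector_fields A. \<forall>z\<in>vector_fields A. \<forall>w\<in>vector_fields A.
      L x y z w = - L y x z w \<and> L x y z w = - L x y w z \<and>
      cyclic_sum (\<lambda>x y z. L x y z w) x y z = 0 \<and>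
      L x y (app_endo \<phi> z) (app_endo \<phi> w) = - L x y z w)"

end

theory Submission
  imports Defs
begin

text \<open>
  Since \<open>T\<close> is a 3-form, \<open>g(D\<^sub>x y, z) = g(\<nabla>\<^sub>x y, z) + T(x, y, z)/2\<close>, and substituting this gives
  \<open>K = R + (D\<^sub>x T(y, z, w) - D\<^sub>y T(x, z, w))/2 + g(T(x, y), T(z, w))/4 + \<sigma>/4\<close>, where \<open>\<sigma>\<close> is the cyclic
  sum of \<open>g(T(x, y), T(z, w))\<close>. All conditions on \<open>K\<close> except the Bianchi identity hold for every
  natural connection. Given the Bianchi identity, \<open>K\<close> is symmetric under exchange of pairs,
  as are \<open>R\<close> and the quadratic terms; this makes \<open>D T\<close> totally skew, and the identity then reads
  \<open>3 D\<^sub>x T(y, z, w) = - \<sigma>\<close>. Conversely the cyclic sum of the formula cancels.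

  All identities are tested against vector fields only, and Lie brackets are differences of
  covariant derivatives, so tangent vectors never have to be extended to vector fields.
\<close>

section \<open>Iterated differentiability and differences\<close>

text \<open>Openness of \<open>S\<close> turns equality on \<open>S\<close> into equality near each
  point, so all directional derivatives agree as well.\<close>

lemma C_k_cong:
  assumes "open S" and "\<And>u. u \<in> S \<Longrightarrow> f u = h u"
  shows "C_k S f k \<longleftrightarrow> C_k S h k"
  using assms(2)
proof (induction k arbitrary: f h)
  case 0
  then show ?case by (simp cong: continuous_on_cong)
next
  case (Suc k)
  have der: "(f has_derivative f') (at u) \<longleftrightarrow> (h has_derivative f') (at u)" if "u \<in> S" for u f'
    using has_derivative_transform_within_open[OF _ assms(1) that] Suc.prems by metis
  \<comment> \<open>\<open>frechet_derivative\<close> chooses some \<open>f'\<close> satisfying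
    \<open>has_derivative\<close>; by \<open>der\<close> both choices are made from the same set, so
    they coincide.\<close>
  have "C_k S (\<lambda>u. frechet_derivative f (at u) v) k \<longleftrightarrow>
      C_k S (\<lambda>u. frechet_derivative h (at u) v) k" for v
    by (rule Suc.IH) (simp add: frechet_derivative_def der)
  then show ?case by (simp add: differentiable_def der)
qed

lemma C_k_diff:
  assumes "open S" and "C_k S f k" and "C_k S h k"
  shows "C_k S (\<lambda>u. f u - h u) k"
  using assms(2,3)
proof (induction k arbitrary: f h)
  case 0
  then show ?case by (simp add: continuous_on_diff)
next
  case (Suc k)
  have "C_k S (\<lambda>u. frechet_derivative (\<lambda>u. f u - h u) (at u) v) k" for v
  proof -
    have "C_k S (\<lambda>u. frechet_derivative f (at u) v - frechet_derivative h (at u) v) k"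
      using Suc by simp
    moreover have "frechet_derivative (\<lambda>u. f u - h u) (at u) v =
        frechet_derivative f (at u) v - frechet_derivative h (at u) v" if "u \<in> S" for u
    proof -
      have "f differentiable at u" "h differentiable at u"
        using Suc.prems that by auto
      then have "((\<lambda>u. f u - h u) has_derivative
          (\<lambda>v. frechet_derivative f (at u) v - frechet_derivative h (at u) v)) (at u)"
        by (intro has_derivative_diff) (simp_all add: frechet_derivative_works)
      from frechet_derivative_at[OF this] show ?thesis by metis
    qed
    ultimately show ?thesis
      using C_k_cong[OF assms(1), of "\<lambda>u. frechet_derivative (\<lambda>u. f u - h u) (at u) v"] by simp
  qed
  then show ?case using Suc.prems by simp
qed

section \<open>Derivations, vector fields and the Jacobi identity\<close>

lemma tangent_spaceD:
  assumes "v \<in> tangent_space A p"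
  shows "f \<in> smooth_functions A \<Longrightarrow> h \<in> smooth_functions A \<Longrightarrow> v (f + h) = v f + v h"
    and "f \<notin> smooth_functions A \<Longrightarrow> v f = 0"
    and "f \<in> smooth_functions A \<Longrightarrow> v (c *\<^sub>R f) = c * v f"
  using assms by (auto simp: tangent_space_def)

context smooth_manifold
begin

lemma smooth_diff:
  assumes "f \<in> smooth_functions A" and "h \<in> smooth_functions A"
  shows "f - h \<in> smooth_functions A"
proof -
  have "C_infinity_on (\<psi> ` U) ((f - h) \<circ> inv_into U \<psi>)" if "(U, \<psi>) \<in> A" for U \<psi>
  proof -
    have "(f - h) \<circ> inv_into U \<psi> = (\<lambda>u. (f \<circ> inv_into U \<psi>) u - (h \<circ> inv_into U \<psi>) u)"
      by (auto simp: fun_eq_iff)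
    moreover have "open (\<psi> ` U)"
      using chart_open[OF that] by simp
    ultimately show ?thesis
      using assms that C_k_diff by (fastforce simp: smooth_functions_def C_infinity_on_def)
  qed
  then show ?thesis by (auto simp: smooth_functions_def)
qed

lemma tangent_diff:
  assumes "v \<in> tangent_space A p" and "f \<in> smooth_functions A" and "h \<in> smooth_functions A"
  shows "v (f - h) = v f - v h"
  using tangent_spaceD(1)[OF assms(1) smooth_diff[OF assms(2,3)] assms(3)] by simp

lemma tangent_zero:
  assumes "v \<in> tangent_space A p"
  shows "v 0 = 0"
  \<comment> \<open>If \<open>0\<close> is smooth, additivity gives \<open>v 0 = v 0 + v 0\<close>;
    otherwise the default value on non-smooth functions applies.\<close>
  using tangent_spaceD(1)[OF assms, of 0 0] tangent_spaceD(2)[OF assms, of 0] by auto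

lemma vector_field_tangent: "x \<in> vector_fields A \<Longrightarrow> x p \<in> tangent_space A p"
  by (simp add: vector_fields_def)

lemma app_field_smooth:
  "x \<in> vector_fields A \<Longrightarrow> f \<in> smooth_functions A \<Longrightarrow> app_field x f \<in> smooth_functions A"
  by (simp add: vector_fields_def)

lemma app_field_diff:
  assumes "x \<in> vector_fields A" and "f \<in> smooth_functions A" and "h \<in> smooth_functions A"
  shows "app_field x (f - h) = app_field x f - app_field x h"
  using tangent_diff[OF vector_field_tangent assms(2,3)] assms(1)
  by (auto simp: app_field_def fun_eq_iff)

lemma app_field_scaleR:
  assumes "x \<in> vector_fields A" and "f \<in> smooth_functions A"
  shows "app_field x (c *\<^sub>R f) = c *\<^sub>R app_field x f"
  using tangent_spaceD(3)[OF vector_field_tangent assms(2)] assms(1)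
  by (auto simp: app_field_def fun_eq_iff scaleR_fun_def)

lemma app_field_uminus:
  assumes "x \<in> vector_fields A" and "f \<in> smooth_functions A"
  shows "app_field x (- f) = - app_field x f"
  using app_field_scaleR[OF assms, of "-1"] by simp

lemma vector_fields_diff:
  assumes "x \<in> vector_fields A" and "y \<in> vector_fields A"
  shows "x - y \<in> vector_fields A"
proof -
  have "(x - y) p \<in> tangent_space A p" for p
  proof -
    have "x p \<in> tangent_space A p" "y p \<in> tangent_space A p"
      using assms by (auto simp: vector_fields_def)
    then show ?thesis by (simp add: tangent_space_def algebra_simps)
  qed
  moreover have "app_field (x - y) f = app_field x f - app_field y f" for f
    by (auto simp: app_field_def)
  ultimately show ?thesis
    using assms smooth_diff by (auto simp: vector_fields_def)
qed

lemma lie_bracket_app: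
  "app_field (lie_bracket x y) f = app_field x (app_field y f) - app_field y (app_field x f)"
  by (auto simp: app_field_def lie_bracket_def)

text \<open>Both inner applications are the zero function, which the outer derivations annihilate.
  This settles the non-smooth case of \<open>jacobi\<close>.\<close>

lemma lie_bracket_nonsmooth:
  assumes "x \<in> vector_fields A" and "y \<in> vector_fields A" and "f \<notin> smooth_functions A"
  shows "app_field (lie_bracket x y) f = 0"
proof -
  have "app_field x f = 0" "app_field y f = 0"
    using assms tangent_spaceD(2)[OF vector_field_tangent] by (auto simp: app_field_def)
  moreover have "app_field x 0 = 0" "app_field y 0 = 0"
    using assms(1,2) tangent_zero[OF vector_field_tangent] by (auto simp: app_field_def)
  ultimately show ?thesis by (simp add: lie_bracket_app)
qed

lemma vfield_eqI: "(\<And>f. app_field x f = app_field y f) \<Longrightarrow> x = y"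
  by (simp add: app_field_def fun_eq_iff)

text \<open>On a smooth \<open>f\<close> the brackets are commutators of operators, and the twelve
  terms cancel in pairs. Closure of the brackets is a hypothesis here; \<open>bracket_closed\<close>
  later supplies it through the Levi-Civita connection.\<close>

lemma jacobi:
  assumes x: "x \<in> vector_fields A" and y: "y \<in> vector_fields A" and z: "z \<in> vector_fields A"
    and "lie_bracket x y \<in> vector_fields A" "lie_bracket y z \<in> vector_fields A"
      "lie_bracket z x \<in> vector_fields A"
  shows "lie_bracket x (lie_bracket y z) + lie_bracket y (lie_bracket z x)
    + lie_bracket z (lie_bracket x y) = 0"
proof (rule vfield_eqI)
  fix f :: "'m \<Rightarrow> real"
  have add: "app_field (u + v) f = app_field u f + app_field v f" for u v :: "'m vfield"
    by (auto simp: app_field_def)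
  have zero: "app_field 0 f = 0"
    by (auto simp: app_field_def)
  show "app_field (lie_bracket x (lie_bracket y z) + lie_bracket y (lie_bracket z x)
    + lie_bracket z (lie_bracket x y)) f = app_field 0 f"
  proof (cases "f \<in> smooth_functions A")
    case True
    then show ?thesis
      using assms by (simp add: add zero lie_bracket_app app_field_diff app_field_smooth)
  next
    case False
    then show ?thesis
      using assms by (simp add: add zero lie_bracket_nonsmooth)
  qed
qed

end

section \<open>Symmetries of skew functions of four arguments\<close>

text \<open>The skewness reduces the Bianchi identities at the four rotations of (x, y, z, w) to
  relations between six values. With B1, ..., B4 for the resulting sums, all signs made positive, B1
  - B2 - B3 + B4 is twice the difference of the two sides.\<close>

lemma pair_symmetry:
  fixes F :: "'a \<Rightarrow> 'a \<Rightarrow> 'a \<Rightarrow> 'a \<Rightarrow> real"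
  assumes skew12: "\<And>x y z w. x \<in> V \<Longrightarrow> y \<in> V \<Longrightarrow> z \<in> V \<Longrightarrow> w \<in> V \<Longrightarrow> F x y z w = - F y x z w"
    and skew34: "\<And>x y z w. x \<in> V \<Longrightarrow> y \<in> V \<Longrightarrow> z \<in> V \<Longrightarrow> w \<in> V \<Longrightarrow> F x y z w = - F x y w z"
    and bianchi: "\<And>x y z w. x \<in> V \<Longrightarrow> y \<in> V \<Longrightarrow> z \<in> V \<Longrightarrow> w \<in> V \<Longrightarrow>
      F x y z w + F y z x w + F z x y w = 0"
    and V: "x \<in> V" "y \<in> V" "z \<in> V" "w \<in> V"
  shows "F x y z w = F z w x y"
proof -
  have "F y z w x = - F y z x w" "F z w y x = - F z w x y" "F w y z x = - F y w z x"
    "F x y w z = - F x y z w" "F w x y z = - F x w y z" "F y w x z = - F y w z x"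
    using V skew12 skew34 by blast+
  moreover have "F w x z y = F x w y z" "F x z w y = F z x y w"
    using V skew12[of w x z y] skew34[of x w z y] skew12[of x z w y] skew34[of z x w y] by simp_all
  ultimately show ?thesis
    using bianchi[OF V] bianchi[OF V(2,3,4,1)] bianchi[OF V(3,4,1,2)] bianchi[OF V(4,1,2,3)]
    by linarith
qed

text \<open>Meant for \<open>E x y z w\<close> = (D_x T)(y, z, w) at a point. With a, b, c for
  \<open>E x y z w\<close>, \<open>E y z x w\<close>, \<open>E z x y w\<close> and d for
  \<open>E w z x y\<close>, the hypothesis \<open>pair\<close> at (x, y, z, w) reads a + b = c - d
  and at (y, z, x, w) reads b + c = a - d; subtracting gives a = c.\<close>

lemma cyclic_of_pair_symmetric:
  fixes E :: "'a \<Rightarrow> 'a \<Rightarrow> 'a \<Rightarrow> 'a \<Rightarrow> real"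
  assumes skew23: "\<And>x y z w. x \<in> V \<Longrightarrow> y \<in> V \<Longrightarrow> z \<in> V \<Longrightarrow> w \<in> V \<Longrightarrow> E x y z w = - E x z y w"
    and skew34: "\<And>x y z w. x \<in> V \<Longrightarrow> y \<in> V \<Longrightarrow> z \<in> V \<Longrightarrow> w \<in> V \<Longrightarrow> E x y z w = - E x y w z"
    and pair: "\<And>x y z w. x \<in> V \<Longrightarrow> y \<in> V \<Longrightarrow> z \<in> V \<Longrightarrow> w \<in> V \<Longrightarrow>
      E x y z w - E y x z w = E z w x y - E w z x y"
    and V: "x \<in> V" "y \<in> V" "z \<in> V" "w \<in> V"
  shows "E x y z w = E z x y w"
proof -
  have "E y x z w = - E y z x w" "E z y x w = - E z x y w"
    using V skew23 by blast+
  moreover have "E z w x y = E z x y w" "E x w y z = E x y z w" "E w x y z = E w z x y"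
    using V skew23[of z w x y] skew34[of z x w y] skew23[of x w y z] skew34[of x y w z]
      skew23[of w z x y] skew34[of w x z y] by simp_all
  ultimately show ?thesis
    using pair[OF V] pair[OF V(2,3,1,4)] by linarith
qed

section \<open>Metric connections and their curvature\<close>

text \<open>Collects what \<open>D\<close> and the Levi-Civita connection have in common; both
  become instances.\<close>

locale metric_connection = smooth_manifold A
  for A :: "('m::{t2_space,second_countable_topology}, 'e::euclidean_space) atlas" +
  fixes r s :: nat and g :: "'m \<Rightarrow> 'm tvec \<Rightarrow> 'm tvec \<Rightarrow> real"
    and D :: "'m vfield \<Rightarrow> 'm vfield \<Rightarrow> 'm vfield"
  assumes metric: "pseudo_riemannian_metric A r s g"
    and linear: "linear_connection A D"
    and cov_metric_zero: "x \<in> vector_fields A \<Longrightarrow> y \<in> vector_fields A \<Longrightarrow> z \<in> vector_fields A \<Longrightarrow>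
      cov_metric D g x y z = 0"
begin

abbreviation G where "G \<equiv> app_metric g"
abbreviation V where "V \<equiv> vector_fields A"

lemma metric_smooth: "x \<in> V \<Longrightarrow> y \<in> V \<Longrightarrow> G x y \<in> smooth_functions A"
  using metric by (simp add: pseudo_riemannian_metric_def)

lemma metric_tangent:
  assumes "u \<in> tangent_space A p" "v \<in> tangent_space A p"
  shows "g p u v = g p v u"
    and "w \<in> tangent_space A p \<Longrightarrow> g p (u + v) w = g p u w + g p v w"
  using metric assms unfolding pseudo_riemannian_metric_def by blast+

lemma metric_sym: "x \<in> V \<Longrightarrow> y \<in> V \<Longrightarrow> G x y = G y x"
  unfolding app_metric_def by (intro ext metric_tangent(1) vector_field_tangent)

lemma metric_add_left: "x \<in> V \<Longrightarrow> y \<in> V \<Longrightarrow> z \<in> V \<Longrightarrow> G (x + y) z = G x z + G y z"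
  by (rule ext) (simp add: app_metric_def metric_tangent(2) vector_field_tangent)

lemma metric_diff_left:
  assumes "x \<in> V" "y \<in> V" "z \<in> V"
  shows "G (x - y) z = G x z - G y z"
  using metric_add_left[OF vector_fields_diff[OF assms(1,2)] assms(2,3)] by simp

lemma metric_diff_right:
  assumes "x \<in> V" "y \<in> V" "z \<in> V"
  shows "G z (x - y) = G z x - G z y"
  using metric_diff_left[OF assms] metric_sym[OF assms(1,3)] metric_sym[OF assms(2,3)]
    metric_sym[OF vector_fields_diff[OF assms(1,2)] assms(3)] by simp

lemma connection_closed: "x \<in> V \<Longrightarrow> y \<in> V \<Longrightarrow> D x y \<in> V"
  \<comment> \<open>All clauses of \<open>linear_connection\<close> sit under a quantifier over
    smooth functions, so one has to be exhibited; \<open>G x x\<close> serves.\<close>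
  using linear metric_smooth[of x x] unfolding linear_connection_def by metis

lemma connection_add:
  assumes "x \<in> V" "y \<in> V" "z \<in> V"
  shows "D (x + y) z = D x z + D y z" "D x (y + z) = D x y + D x z"
  using assms linear metric_smooth[of x x] unfolding linear_connection_def by blast+

lemma connection_diff_left:
  assumes "x \<in> V" "y \<in> V" "z \<in> V"
  shows "D (x - y) z = D x z - D y z"
  using connection_add(1)[OF vector_fields_diff[OF assms(1,2)] assms(2,3)] by simp

lemma connection_diff_right:
  assumes "x \<in> V" "y \<in> V" "z \<in> V"
  shows "D x (y - z) = D x y - D x z"
  using connection_add(2)[OF assms(1) vector_fields_diff[OF assms(2,3)] assms(3)] by simp

lemma metric_compatible:
  assumes "x \<in> V" "y \<in> V" "z \<in> V"
  shows "G (D x y) z = app_field x (G y z) - G y (D x z)"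
  using cov_metric_zero[OF assms] by (simp add: cov_metric_def algebra_simps)

lemma curvature_closed:
  assumes "x \<in> V" "y \<in> V" "z \<in> V" "lie_bracket x y \<in> V"
  shows "curvature D x y z \<in> V"
  using assms by (simp add: curvature_def connection_closed vector_fields_diff)

lemma curvature_swap:
  assumes "x \<in> V" "y \<in> V" "z \<in> V" "lie_bracket x y \<in> V"
  shows "curvature D y x z = - curvature D x y z"
proof -
  let ?b = "lie_bracket x y"
  \<comment> \<open>The negative of b is written as (b - b) - b, so that the rules for differences
    apply.\<close>
  have "lie_bracket y x = (?b - ?b) - ?b"
    by (auto simp: lie_bracket_def fun_eq_iff)
  then have "D (lie_bracket y x) z = (D ?b z - D ?b z) - D ?b z"
    using assms connection_diff_left vector_fields_diff by metis
  then show ?thesis by (simp add: curvature_def)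
qed

lemma curvature4_swap12:
  assumes "x \<in> V" "y \<in> V" "z \<in> V" "w \<in> V" "lie_bracket x y \<in> V"
  shows "curvature4 g D x y z w = - curvature4 g D y x z w"
proof -
  let ?K = "curvature D x y z"
  have K: "?K \<in> V"
    using assms curvature_closed by blast
  have "curvature D y x z = (?K - ?K) - ?K"
    using assms curvature_swap by simp
  then have "G (curvature D y x z) w = (G ?K w - G ?K w) - G ?K w"
    using assms(4) K metric_diff_left vector_fields_diff by metis
  then show ?thesis by (simp add: curvature4_def)
qed

text \<open>Metric compatibility moves the outer derivative off the iterated one. Only first
  covariant derivatives remain inside \<open>G\<close>, which is what a comparison of two
  connections can substitute into.\<close>

lemma curvature4_expand:
  assumes "x \<in> V" "y \<in> V" "z \<in> V" "w \<in> V" "lie_bracket x y \<in> V"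
  shows "curvature4 g D x y z w =
    app_field x (G (D y z) w) - G (D y z) (D x w)
    - (app_field y (G (D x z) w) - G (D x z) (D y w)) - G (D (lie_bracket x y) z) w"
proof -
  have "curvature4 g D x y z w =
      G (D x (D y z)) w - G (D y (D x z)) w - G (D (lie_bracket x y) z) w"
    using assms
    by (simp add: curvature4_def curvature_def metric_diff_left connection_closed vector_fields_diff)
  then show ?thesis
    using assms metric_compatible[of x "D y z" w] metric_compatible[of y "D x z" w]
    by (simp add: connection_closed)
qed

text \<open>The part symmetric in z, w is the commutator of x and y minus their bracket, applied to
  the function \<open>G z w\<close>, hence zero.\<close>

lemma curvature4_swap34:
  assumes "x \<in> V" "y \<in> V" "z \<in> V" "w \<in> V" "lie_bracket x y \<in> V"
  shows "curvature4 g D x y z w = - curvature4 g D x y w z"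
proof -
  have comp: "app_field u (G (D v z) w) =
      app_field u (app_field v (G z w)) - app_field u (G (D v w) z)" if "u \<in> V" "v \<in> V" for u v
    using assms that metric_compatible[of v z w] metric_sym[of z "D v w"]
    by (simp add: app_field_diff app_field_smooth metric_smooth connection_closed)
  have bracket: "G (D (lie_bracket x y) z) w =
      app_field (lie_bracket x y) (G z w) - G (D (lie_bracket x y) w) z"
    using assms metric_compatible metric_sym[of z] by (simp add: connection_closed)
  have sym: "G (D x z) (D y w) = G (D y w) (D x z)" "G (D y z) (D x w) = G (D x w) (D y z)"
    using assms by (simp_all add: metric_sym connection_closed)
  show ?thesis
    unfolding curvature4_expand[OF assms] curvature4_expand[OF assms(1,2,4,3,5)]
      comp[OF assms(1,2)] comp[OF assms(2,1)] bracket sym lie_bracket_app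
    by (simp add: algebra_simps)
qed

end

section \<open>Connections with skew torsion against the Levi-Civita connection\<close>

locale skew_torsion_connection = metric_connection A r s g D + LC: metric_connection A r s g nabla
  for A :: "('m::{t2_space,second_countable_topology}, 'e::euclidean_space) atlas"
    and r s :: nat and g :: "'m \<Rightarrow> 'm tvec \<Rightarrow> 'm tvec \<Rightarrow> real"
    and D nabla :: "'m vfield \<Rightarrow> 'm vfield \<Rightarrow> 'm vfield" +
  assumes torsion_LC: "x \<in> vector_fields A \<Longrightarrow> y \<in> vector_fields A \<Longrightarrow> torsion nabla x y = 0"
    and torsion_skew12: "x \<in> vector_fields A \<Longrightarrow> y \<in> vector_fields A \<Longrightarrow> z \<in> vector_fields A \<Longrightarrow>
      torsion3 g D x y z = - torsion3 g D y x z"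
    and torsion_skew23: "x \<in> vector_fields A \<Longrightarrow> y \<in> vector_fields A \<Longrightarrow> z \<in> vector_fields A \<Longrightarrow>
      torsion3 g D x y z = - torsion3 g D x z y"
begin

abbreviation T where "T \<equiv> torsion D"
abbreviation T3 where "T3 \<equiv> torsion3 g D"

lemma bracket_LC: "x \<in> V \<Longrightarrow> y \<in> V \<Longrightarrow> lie_bracket x y = nabla x y - nabla y x"
  using torsion_LC by (simp add: torsion_def)

lemma bracket_closed: "x \<in> V \<Longrightarrow> y \<in> V \<Longrightarrow> lie_bracket x y \<in> V"
  by (simp add: bracket_LC LC.connection_closed vector_fields_diff)

lemma torsion_closed: "x \<in> V \<Longrightarrow> y \<in> V \<Longrightarrow> T x y \<in> V"
  by (simp add: torsion_def connection_closed bracket_closed vector_fields_diff)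

lemma torsion3_smooth: "x \<in> V \<Longrightarrow> y \<in> V \<Longrightarrow> z \<in> V \<Longrightarrow> T3 x y z \<in> smooth_functions A"
  by (simp add: torsion3_def metric_smooth torsion_closed)

text \<open>Vanishing torsion rewrites each nested bracket by second covariant derivatives
  (\<open>nest\<close>); the Jacobi identity then becomes the cyclic sum of curvatures.\<close>

lemma curvature_LC_bianchi:
  assumes "x \<in> V" "y \<in> V" "z \<in> V"
  shows "curvature nabla x y z + curvature nabla y z x + curvature nabla z x y = 0"
proof -
  have nest: "lie_bracket u (lie_bracket v w) =
      nabla u (nabla v w) - nabla u (nabla w v) - nabla (lie_bracket v w) u"
    if "u \<in> V" "v \<in> V" "w \<in> V" for u v w
  proof -
    have "nabla u (lie_bracket v w) = nabla u (nabla v w) - nabla u (nabla w v)"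
      using that by (simp add: bracket_LC LC.connection_diff_right LC.connection_closed)
    then show ?thesis
      using bracket_LC[OF that(1) bracket_closed[OF that(2,3)]] by simp
  qed
  show ?thesis
    using jacobi[OF assms] assms
    by (simp add: nest curvature_def bracket_closed algebra_simps)
qed

lemma curvature4_LC_bianchi:
  assumes "x \<in> V" "y \<in> V" "z \<in> V" "w \<in> V"
  shows "curvature4 g nabla x y z w + curvature4 g nabla y z x w + curvature4 g nabla z x y w = 0"
proof -
  let ?a = "curvature nabla x y z" and ?b = "curvature nabla y z x" and ?c = "curvature nabla z x y"
  have closed: "?a \<in> V" "?b \<in> V" "?c \<in> V"
    using assms by (simp_all add: LC.curvature_closed bracket_closed)
  have "?c = (?a - ?a) - ?a - ?b"
    using curvature_LC_bianchi[OF assms(1-3)] by (simp add: algebra_simps eq_neg_iff_add_eq_0)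
  then have "G ?c w = (G ?a w - G ?a w) - G ?a w - G ?b w"
    using assms(4) closed metric_diff_left vector_fields_diff by metis
  then show ?thesis by (simp add: curvature4_def)
qed

lemma torsion3_cyclic:
  assumes "x \<in> V" "y \<in> V" "z \<in> V"
  shows "T3 x y z = T3 y z x"
  using torsion_skew12[OF assms] torsion_skew23[OF assms(2,1,3)] by simp

text \<open>The contorsion \<open>g((D - nabla)\<^sub>x y, z)\<close> is skew in \<open>y, z\<close> and its alternation in \<open>x, y\<close> is the
  torsion, so the usual Koszul permutation argument determines it.\<close>

lemma connection_difference:
  assumes "x \<in> V" "y \<in> V" "z \<in> V"
  shows "G (nabla x y) z p = G (D x y) z p - T3 x y z p / 2"
proof -
  have skew: "G (D u v) w p - G (nabla u v) w p = - (G (D u w) v p - G (nabla u w) v p)"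
    if "u \<in> V" "v \<in> V" "w \<in> V" for u v w
    using that metric_compatible[of u v w] LC.metric_compatible[of u v w]
      metric_sym[of v "D u w"] metric_sym[of v "nabla u w"]
    by (simp add: connection_closed LC.connection_closed)
  have tors: "T3 u v w p =
      (G (D u v) w p - G (nabla u v) w p) - (G (D v u) w p - G (nabla v u) w p)"
    if "u \<in> V" "v \<in> V" "w \<in> V" for u v w
    using that
    by (simp add: torsion3_def torsion_def bracket_LC metric_diff_left connection_closed
        LC.connection_closed vector_fields_diff)
  have "T3 y z x p = T3 x y z p" "T3 z x y p = T3 x y z p"
    using assms torsion3_cyclic by metis+
  \<comment> \<open>With a, b, c for the contorsion at the three rotations, skewness turns the
    torsion values into a + b, b + c and c + a. These are equal, so a is half of each.\<close>
  then show ?thesis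
    using tors[OF assms] tors[OF assms(2,3,1)] tors[OF assms(3,1,2)]
      skew[OF assms] skew[OF assms(2,3,1)] skew[OF assms(3,1,2)] by linarith
qed

text \<open>This is (D_x T)(y, z, w): the first argument is the direction of
  differentiation.\<close>

definition cov_torsion :: "'m vfield \<Rightarrow> 'm vfield \<Rightarrow> 'm vfield \<Rightarrow> 'm vfield \<Rightarrow> 'm \<Rightarrow> real"
  where "cov_torsion x y z w =
    app_field x (T3 y z w) - T3 (D x y) z w - T3 y (D x z) w - T3 y z (D x w)"

lemma cov_torsion_skew:
  assumes "x \<in> V" "y \<in> V" "z \<in> V" "w \<in> V"
  shows "cov_torsion x y z w = - cov_torsion x z y w"
    and "cov_torsion x y z w = - cov_torsion x y w z"
proof -
  show "cov_torsion x y z w = - cov_torsion x z y w"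
    using assms torsion_skew12[of y z w] torsion_skew12[of "D x y" z w]
      torsion_skew12[of y "D x z" w] torsion_skew12[of y z "D x w"]
    by (simp add: cov_torsion_def connection_closed app_field_uminus torsion3_smooth)
  show "cov_torsion x y z w = - cov_torsion x y w z"
    using assms torsion_skew23[of y z w] torsion_skew23[of "D x y" z w]
      torsion_skew23[of y "D x z" w] torsion_skew23[of y z "D x w"]
    by (simp add: cov_torsion_def connection_closed app_field_uminus torsion3_smooth)
qed

definition torsion_square :: "'m vfield \<Rightarrow> 'm vfield \<Rightarrow> 'm vfield \<Rightarrow> 'm vfield \<Rightarrow> 'm \<Rightarrow> real"
  where "torsion_square x y z w = G (T x y) (T z w)"

lemma torsion_square_sym:
  assumes "x \<in> V" "y \<in> V" "z \<in> V" "w \<in> V"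
  shows "torsion_square x y z w = torsion_square z w x y"
    and "torsion_square x y z w = - torsion_square y x z w"
    and "torsion_square x y z w = - torsion_square x y w z"
proof -
  have sym: "torsion_square x y z w = torsion_square z w x y"
    if "x \<in> V" "y \<in> V" "z \<in> V" "w \<in> V" for x y z w
    using that by (simp add: torsion_square_def metric_sym torsion_closed)
  have skew: "torsion_square x y z w = - torsion_square y x z w"
    if "x \<in> V" "y \<in> V" "z \<in> V" "w \<in> V" for x y z w
    using that torsion_skew12[of x y "T z w"]
    by (simp add: torsion_square_def torsion3_def torsion_closed)
  show "torsion_square x y z w = torsion_square z w x y"
    "torsion_square x y z w = - torsion_square y x z w"
    using assms sym skew by blast+
  show "torsion_square x y z w = - torsion_square x y w z"
    using assms sym[of x y z w] skew[of z w x y] sym[of w z x y] by simp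
qed

text \<open>Each \<open>nabla\<close> in the expanded curvature is replaced by \<open>D\<close>
  minus half the torsion. The terms linear in T assemble into the two derivatives of T; the products
  give the quarters, and the torsion hidden in the bracket gives the half.\<close>

lemma curvature_relation:
  assumes x: "x \<in> V" and y: "y \<in> V" and z: "z \<in> V" and w: "w \<in> V"
  shows "curvature4 g D x y z w p = curvature4 g nabla x y z w p
    + (cov_torsion x y z w p - cov_torsion y x z w p) / 2
    + torsion_square x y z w p / 2
    + (torsion_square y z x w p + torsion_square z x y w p) / 4"
proof -
  have der: "app_field u (G (nabla v z) w) p =
      app_field u (G (D v z) w) p - app_field u (T3 v z w) p / 2"
    if "u \<in> V" "v \<in> V" for u v
  proof -
    \<comment> \<open>The pointwise identity must be lifted to an equation of functions before
      \<open>u\<close> can differentiate it.\<close>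
    have eq: "(1/2) *\<^sub>R T3 v z w = G (D v z) w - G (nabla v z) w"
      using connection_difference[OF that(2) z w] by (simp add: fun_eq_iff scaleR_fun_def)
    have "(1/2) *\<^sub>R app_field u (T3 v z w) = app_field u (G (D v z) w - G (nabla v z) w)"
      unfolding eq[symmetric] by (rule app_field_scaleR[symmetric])
        (use that z w torsion3_smooth in auto)
    also have "\<dots> = app_field u (G (D v z) w) - app_field u (G (nabla v z) w)"
      using that z w
      by (simp add: app_field_diff metric_smooth connection_closed LC.connection_closed)
    finally show ?thesis by (simp add: fun_eq_iff scaleR_fun_def algebra_simps)
  qed
  have prod: "G (nabla v z) (nabla u w) p = G (D v z) (D u w) p + T3 u (D v z) w p / 2
      - T3 v z (D u w) p / 2 + torsion_square v z u w p / 4"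
    if u: "u \<in> V" and v: "v \<in> V" for u v
  proof -
    have "G (nabla v z) (nabla u w) p = G (D v z) (nabla u w) p - T3 v z (nabla u w) p / 2"
      using connection_difference[OF v z, of "nabla u w"] u w by (simp add: LC.connection_closed)
    moreover have "G (D v z) (nabla u w) p = G (D v z) (D u w) p - T3 u w (D v z) p / 2"
      using connection_difference[OF u w, of "D v z"] u v z w metric_sym[of "D v z"]
      by (simp add: LC.connection_closed connection_closed)
    \<comment> \<open>\<open>T3 v z\<close> is \<open>G (T v z)\<close>, so the same difference
      formula with third argument \<open>T v z\<close> produces the quadratic term.\<close>
    moreover have "T3 v z (nabla u w) p = T3 v z (D u w) p - torsion_square v z u w p / 2"
      using connection_difference[OF u w, of "T v z"] u v z w metric_sym[of "T v z"]
      by (simp add: LC.connection_closed connection_closed torsion_closed torsion3_def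
          torsion_square_def)
    moreover have "T3 u w (D v z) p = - T3 u (D v z) w p"
      using torsion_skew23[of u w "D v z"] u v z w by (simp add: connection_closed)
    ultimately show ?thesis by linarith
  qed
  \<comment> \<open>Moves the bracket into the last slot, where it is a plain argument of
    \<open>G\<close> and can be split into its three summands.\<close>
  have rotate: "T3 u z w p = T3 z w u p" if "u \<in> V" for u
    using torsion3_cyclic[OF that z w] by simp
  have "T3 z w (lie_bracket x y) p =
      T3 z w (D x y) p - T3 z w (D y x) p - torsion_square z w x y p"
  proof -
    have "lie_bracket x y = D x y - D y x - T x y"
      by (simp add: torsion_def)
    then show ?thesis
      using x y z w
      by (simp add: torsion3_def torsion_square_def metric_diff_right torsion_closed
          connection_closed vector_fields_diff)
  qed
  then have "T3 (lie_bracket x y) z w p =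
      T3 (D x y) z w p - T3 (D y x) z w p - torsion_square x y z w p"
    using x y z w torsion_square_sym(1)[OF x y z w] rotate[OF bracket_closed[OF x y]]
      rotate[of "D x y"] rotate[of "D y x"]
    by (simp add: connection_closed)
  then have "G (nabla (lie_bracket x y) z) w p = G (D (lie_bracket x y) z) w p
      - (T3 (D x y) z w p - T3 (D y x) z w p - torsion_square x y z w p) / 2"
    using connection_difference[OF bracket_closed[OF x y] z w] by simp
  moreover have "torsion_square x z y w p = - torsion_square z x y w p"
    using torsion_square_sym(2)[OF x z y w] by simp
  ultimately show ?thesis
    using x y z w der[of x y] der[of y x] prod[of x y] prod[of y x]
    by (simp add: curvature4_expand LC.curvature4_expand bracket_closed cov_torsion_def field_simps)
qed

text \<open>The Levi-Civita part drops out. By skewness each derivative of T occurs twice with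
  factor 1/2, and each square collects 1/2 + 1/4 + 1/4 = 1.\<close>

lemma curvature_bianchi:
  assumes "x \<in> V" "y \<in> V" "z \<in> V" "w \<in> V"
  shows "curvature4 g D x y z w p + curvature4 g D y z x w p + curvature4 g D z x y w p =
    cov_torsion x y z w p + cov_torsion y z x w p + cov_torsion z x y w p
    + (torsion_square x y z w p + torsion_square y z x w p + torsion_square z x y w p)"
proof -
  have "curvature4 g nabla x y z w p + curvature4 g nabla y z x w p + curvature4 g nabla z x y w p = 0"
    using curvature4_LC_bianchi[OF assms] by (simp add: fun_eq_iff)
  moreover have "cov_torsion y x z w p = - cov_torsion y z x w p"
    "cov_torsion z y x w p = - cov_torsion z x y w p"
    "cov_torsion x z y w p = - cov_torsion x y z w p"
    using assms cov_torsion_skew(1)[of y x z w] cov_torsion_skew(1)[of z y x w]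
      cov_torsion_skew(1)[of x z y w] by simp_all
  ultimately show ?thesis
    using curvature_relation[OF assms, of p] curvature_relation[OF assms(2,3,1,4), of p]
      curvature_relation[OF assms(3,1,2,4), of p] by (simp add: field_simps)
qed

text \<open>The term with 1/12 is already cyclic and so counts three times, cancelling the cyclic
  sum of the term with 1/4.\<close>

lemma bianchi_of_curvature_formula:
  assumes formula: "\<And>x y z w. x \<in> V \<Longrightarrow> y \<in> V \<Longrightarrow> z \<in> V \<Longrightarrow> w \<in> V \<Longrightarrow>
      curvature4 g D x y z w p = curvature4 g nabla x y z w p + torsion_square x y z w p / 4
      - (torsion_square x y z w p + torsion_square y z x w p + torsion_square z x y w p) / 12"
    and V: "x \<in> V" "y \<in> V" "z \<in> V" "w \<in> V"
  shows "curvature4 g D x y z w p + curvature4 g D y z x w p + curvature4 g D z x y w p = 0"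
  using fun_cong[OF curvature4_LC_bianchi[OF V], of p] formula[OF V] formula[OF V(2,3,1,4)]
    formula[OF V(3,1,2,4)]
  by (simp add: field_simps)

text \<open>The pair symmetries of both curvatures and of the torsion terms carry over to the skew part of
  \<open>(D\<^sub>x T)(y, z, w)\<close> in \<open>x, y\<close>, which forces \<open>D T\<close> to be totally skew; the Bianchi
  identity then determines it.\<close>

lemma curvature_formula_of_bianchi:
  assumes bianchi: "\<And>x y z w. x \<in> V \<Longrightarrow> y \<in> V \<Longrightarrow> z \<in> V \<Longrightarrow> w \<in> V \<Longrightarrow>
      curvature4 g D x y z w p + curvature4 g D y z x w p + curvature4 g D z x y w p = 0"
    and V: "x \<in> V" "y \<in> V" "z \<in> V" "w \<in> V"
  shows "curvature4 g D x y z w p = curvature4 g nabla x y z w p + torsion_square x y z w p / 4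
      - (torsion_square x y z w p + torsion_square y z x w p + torsion_square z x y w p) / 12"
proof -
  define K where "K = (\<lambda>x y z w. curvature4 g D x y z w p)"
  define R where "R = (\<lambda>x y z w. curvature4 g nabla x y z w p)"
  define E where "E = (\<lambda>x y z w. cov_torsion x y z w p)"
  define Q where "Q = (\<lambda>x y z w. torsion_square x y z w p)"
  have relation: "K x y z w = R x y z w + (E x y z w - E y x z w) / 2 + Q x y z w / 2
      + (Q y z x w + Q z x y w) / 4" if "x \<in> V" "y \<in> V" "z \<in> V" "w \<in> V" for x y z w
    using curvature_relation[OF that] by (simp add: K_def R_def E_def Q_def)
  have K_skew: "K x y z w = - K y x z w" "K x y z w = - K x y w z"
    if "x \<in> V" "y \<in> V" "z \<in> V" "w \<in> V" for x y z w
    using fun_cong[OF curvature4_swap12[OF that bracket_closed[OF that(1,2)]], of p]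
      fun_cong[OF curvature4_swap34[OF that bracket_closed[OF that(1,2)]], of p]
    by (simp_all add: K_def)
  have R_skew: "R x y z w = - R y x z w" "R x y z w = - R x y w z"
    if "x \<in> V" "y \<in> V" "z \<in> V" "w \<in> V" for x y z w
    using fun_cong[OF LC.curvature4_swap12[OF that bracket_closed[OF that(1,2)]], of p]
      fun_cong[OF LC.curvature4_swap34[OF that bracket_closed[OF that(1,2)]], of p]
    by (simp_all add: R_def)
  have K_bianchi: "K x y z w + K y z x w + K z x y w = 0"
    if "x \<in> V" "y \<in> V" "z \<in> V" "w \<in> V" for x y z w
    using bianchi[OF that] by (simp add: K_def)
  have R_bianchi: "R x y z w + R y z x w + R z x y w = 0"
    if "x \<in> V" "y \<in> V" "z \<in> V" "w \<in> V" for x y z w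
    using fun_cong[OF curvature4_LC_bianchi[OF that], of p] by (simp add: R_def)
  have E_skew: "E x y z w = - E x z y w" "E x y z w = - E x y w z"
    if "x \<in> V" "y \<in> V" "z \<in> V" "w \<in> V" for x y z w
    using cov_torsion_skew[OF that] by (simp_all add: E_def)
  have pair: "E x y z w - E y x z w = E z w x y - E w z x y"
    if V: "x \<in> V" "y \<in> V" "z \<in> V" "w \<in> V" for x y z w
  proof -
    \<comment> \<open>Each of the three quadratic terms in \<open>relation\<close> is fixed by
      exchanging (x, y) with (z, w). Once K and R are known to be pair symmetric, only the
      \<open>E\<close> terms are left.\<close>
    have "Q z w x y = Q x y z w"
      using torsion_square_sym(1)[OF V] by (simp add: Q_def)
    moreover have "Q w x z y = Q y z x w"
      using torsion_square_sym(1)[OF V(4,1,3,2)] torsion_square_sym(2)[OF V(3,2,4,1)]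
        torsion_square_sym(3)[OF V(2,3,4,1)] by (simp add: Q_def)
    moreover have "Q x z w y = Q z x y w"
      using torsion_square_sym(2)[OF V(1,3,4,2)] torsion_square_sym(3)[OF V(3,1,4,2)]
      by (simp add: Q_def)
    moreover have "K x y z w = K z w x y"
      using K_skew K_bianchi V by (rule pair_symmetry)
    moreover have "R x y z w = R z w x y"
      using R_skew R_bianchi V by (rule pair_symmetry)
    ultimately show ?thesis
      using relation[OF V] relation[OF V(3,4,1,2)] by (simp add: field_simps)
  qed
  have cyc: "E x y z w = E z x y w" if "x \<in> V" "y \<in> V" "z \<in> V" "w \<in> V" for x y z w
    using E_skew pair that by (rule cyclic_of_pair_symmetric)
  have "K x y z w + K y z x w + K z x y w =
      E x y z w + E y z x w + E z x y w + (Q x y z w + Q y z x w + Q z x y w)"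
    using curvature_bianchi[OF V] by (simp add: K_def E_def Q_def)
  \<comment> \<open>The three rotations of \<open>E\<close> agree, so each is -\<sigma>/3, where
    \<sigma> is the cyclic sum of \<open>Q\<close>. The relation has Q/4 + \<sigma>/4 besides, and
    -1/3 + 1/4 = -1/12.\<close>
  then have "K x y z w = R x y z w + Q x y z w / 4 - (Q x y z w + Q y z x w + Q z x y w) / 12"
    using K_bianchi[OF V] relation[OF V] cyc[OF V] cyc[OF V(3,1,2,4)] E_skew(1)[OF V(2,1,3,4)]
    by (simp add: field_simps)
  then show ?thesis by (simp add: K_def R_def Q_def)
qed

end

section \<open>Compatibility with the contact structure and the equivalence\<close>

text \<open>As D \<phi> = 0, the curvature operator commutes with \<phi>. As D \<eta> = 0, the form
  \<eta> of a curvature value is the commutator minus the bracket applied to \<eta>(z), hence zero,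
  and the B-metric identity keeps only its first term.\<close>

lemma (in almost_contact_B_metric) natural_curvature_phi:
  assumes nat: "natural_connection A \<phi> \<xi> \<eta> g D"
    and x: "x \<in> vector_fields A" and y: "y \<in> vector_fields A"
    and z: "z \<in> vector_fields A" and w: "w \<in> vector_fields A"
    and b: "lie_bracket x y \<in> vector_fields A"
  shows "curvature4 g D x y (app_endo \<phi> z) (app_endo \<phi> w) = - curvature4 g D x y z w"
proof -
  interpret metric_connection A n "n + 1" g D
    using nat metric by unfold_locales (auto simp: natural_connection_def)
  have endo: "app_endo \<phi> u \<in> V" if "u \<in> V" for u
    using endomorphism that by (simp add: endomorphism_field_def)
  have endo_diff: "app_endo \<phi> (u - v) = app_endo \<phi> u - app_endo \<phi> v" if "u \<in> V" "v \<in> V" for u v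
  proof -
    have "\<phi> p ((u - v) p + v p) = \<phi> p ((u - v) p) + \<phi> p (v p)" for p
      using endomorphism vector_field_tangent[OF vector_fields_diff[OF that]]
        vector_field_tangent[OF that(2)]
      unfolding endomorphism_field_def by blast
    then have "\<phi> p (u p) = \<phi> p ((u - v) p) + \<phi> p (v p)" for p
      by (metis diff_add_cancel fun_diff_def)
    then show ?thesis by (simp add: app_endo_def fun_eq_iff)
  qed
  have form: "app_form \<eta> u \<in> smooth_functions A" if "u \<in> V" for u
    using eta_form that by (simp add: one_form_def)
  have form_diff: "app_form \<eta> (u - v) = app_form \<eta> u - app_form \<eta> v" if "u \<in> V" "v \<in> V" for u v
  proof -
    have "\<eta> p ((u - v) p + v p) = \<eta> p ((u - v) p) + \<eta> p (v p)" for p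
      using eta_form vector_field_tangent[OF vector_fields_diff[OF that]]
        vector_field_tangent[OF that(2)]
      unfolding one_form_def by blast
    then have "\<eta> p (u p) = \<eta> p ((u - v) p) + \<eta> p (v p)" for p
      by (metis diff_add_cancel fun_diff_def)
    then show ?thesis by (simp add: app_form_def fun_eq_iff)
  qed
  have D_endo: "D u (app_endo \<phi> v) = app_endo \<phi> (D u v)" if "u \<in> V" "v \<in> V" for u v
    using nat that by (simp add: natural_connection_def cov_endo_def)
  have D_form: "app_form \<eta> (D u v) = app_field u (app_form \<eta> v)" if "u \<in> V" "v \<in> V" for u v
    using nat that by (simp add: natural_connection_def cov_form_def)
  let ?K = "curvature D x y z"
  have K: "?K \<in> V"
    using x y z b curvature_closed by blast
  have "curvature D x y (app_endo \<phi> z) = app_endo \<phi> ?K"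
    using x y z b
    by (simp add: curvature_def D_endo endo_diff connection_closed vector_fields_diff)
  moreover have "app_form \<eta> ?K = 0"
    using x y z b
    by (simp add: curvature_def form_diff D_form connection_closed vector_fields_diff form
        lie_bracket_app)
  then have "\<eta> p (?K p) = 0" for p
    by (simp add: app_form_def fun_eq_iff)
  ultimately show ?thesis
    using B_metric[OF vector_field_tangent[OF K] vector_field_tangent[OF w]]
    by (intro ext) (simp add: curvature4_def app_metric_def app_endo_def)
qed

theorem theorem8:
  fixes A :: "('m::{t2_space,second_countable_topology}, 'e::euclidean_space) atlas"
    and n :: nat
    and \<phi> :: "'m \<Rightarrow> 'm tvec \<Rightarrow> 'm tvec" and \<xi> :: "'m vfield"
    and \<eta> :: "'m \<Rightarrow> 'm tvec \<Rightarrow> real" and g :: "'m \<Rightarrow> 'm tvec \<Rightarrow> 'm tvec \<Rightarrow> real"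
    and nabla D :: "'m vfield \<Rightarrow> 'm vfield \<Rightarrow> 'm vfield"
  assumes "almost_contact_B_metric A n \<phi> \<xi> \<eta> g"
    and "levi_civita A g nabla"
    and "phiKT_connection A \<phi> \<xi> \<eta> g D"
  shows "phi_Kahler_type A \<phi> (curvature4 g D) \<longleftrightarrow>
    (\<forall>x\<in>vector_fields A. \<forall>y\<in>vector_fields A. \<forall>z\<in>vector_fields A. \<forall>w\<in>vector_fields A.
      curvature4 g D x y z w =
        curvature4 g nabla x y z w
        + (1/4) *\<^sub>R app_metric g (torsion D x y) (torsion D z w)
        - (1/12) *\<^sub>R cyclic_sum (\<lambda>x y z. app_metric g (torsion D x y) (torsion D z w)) x y z)"
proof -
  interpret almost_contact_B_metric A n \<phi> \<xi> \<eta> g by fact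
  have nat: "natural_connection A \<phi> \<xi> \<eta> g D"
    using assms(3) by (simp add: phiKT_connection_def)
  interpret skew_torsion_connection A n "n + 1" g D nabla
    using metric nat assms(2,3)
    unfolding natural_connection_def levi_civita_def phiKT_connection_def
    by unfold_locales blast+
  \<comment> \<open>Both sides of the equivalence are compared through the Bianchi identity at every
    point \<open>p\<close>.\<close>
  have "phi_Kahler_type A \<phi> (curvature4 g D) \<longleftrightarrow> (\<forall>x\<in>V. \<forall>y\<in>V. \<forall>z\<in>V. \<forall>w\<in>V. \<forall>p.
      curvature4 g D x y z w p + curvature4 g D y z x w p + curvature4 g D z x y w p = 0)"
    (is "_ \<longleftrightarrow> ?bianchi")
  proof
    assume "phi_Kahler_type A \<phi> (curvature4 g D)"
    then show ?bianchi
      unfolding phi_Kahler_type_def cyclic_sum_def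
      by (metis (no_types, lifting) plus_fun_def zero_fun_def)
  next
    assume bianchi: ?bianchi
    show "phi_Kahler_type A \<phi> (curvature4 g D)"
      unfolding phi_Kahler_type_def
    proof (intro ballI conjI)
      fix x y z w
      assume V: "x \<in> V" "y \<in> V" "z \<in> V" "w \<in> V"
      note b = bracket_closed[OF V(1,2)]
      show "curvature4 g D x y z w = - curvature4 g D y x z w"
        by (rule curvature4_swap12[OF V b])
      show "curvature4 g D x y z w = - curvature4 g D x y w z"
        by (rule curvature4_swap34[OF V b])
      show "cyclic_sum (\<lambda>x y z. curvature4 g D x y z w) x y z = 0"
        using bianchi V by (intro ext) (simp add: cyclic_sum_def)
      show "curvature4 g D x y (app_endo \<phi> z) (app_endo \<phi> w) = - curvature4 g D x y z w"
        by (rule natural_curvature_phi[OF nat V b])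
    qed
  qed
  also have "\<dots> \<longleftrightarrow> (\<forall>x\<in>V. \<forall>y\<in>V. \<forall>z\<in>V. \<forall>w\<in>V. \<forall>p.
      curvature4 g D x y z w p = curvature4 g nabla x y z w p + torsion_square x y z w p / 4
      - (torsion_square x y z w p + torsion_square y z x w p + torsion_square z x y w p) / 12)"
    (is "_ \<longleftrightarrow> ?formula")
  proof
    assume ?bianchi
    then show ?formula
      by (intro ballI allI curvature_formula_of_bianchi) blast+
  next
    assume ?formula
    then show ?bianchi
      by (intro ballI allI bianchi_of_curvature_formula) blast+
  qed
  finally show ?thesis
    by (simp add: fun_eq_iff cyclic_sum_def torsion_square_def scaleR_fun_def)
qed

end
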